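(* Let $1\le t\le n$ be integers and let $C\subseteq \mathrm{GF}(2)^n$ be nonempty. Then $C$, viewed as a $|C|\times n$ matrix whose rows are the vectors of $C$, is an orthogonal array of size $|C|$, $n$ constraints, $2$ levels, strength $t$ and index $|C|/2^t$ if and only if $\hat 1_C(w)=0$ for all $w\in \mathrm{GF}(2)^n$ with $1\le \mathrm{wt}(w)\le t$.
   Context: An $M\times n$ matrix with entries from a set of $q$ elements is an orthogonal array of size $M$, $n$ constraints, $q$ levels, strength $t$ and index $\lambda$ if any set of $t$ columns contains all $q^t$ possible row vectors exactly $\lambda$ times each (so $M=\lambda q^t$). Here $q=2$. $1_C:\mathrm{GF}(2)^n\to\{0,1\}\subset\mathbb{R}$ is the indicator function of $C$, and $\hat 1_C(w)=\sum_{x\in \mathrm{GF}(2)^n}1_C(x)(-1)^{w\cdot x}$ with $w\cdot x=\sum_iw_ix_i$. $\mathrm{wt}(w)$ is the Hamming weight of $w$. *)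

theory Defs
  imports
    Complex_Main
    "HOL-Library.Z2"
    "HOL-Library.FuncSet"
    "HOL-Library.Indicator_Function"
    "Jordan_Normal_Form.Matrix"
begin

text \<open>
  The arguments are the matrix, the set of symbols, the size, the number of constraints, the
  number of levels, the strength and the index.  A set of columns is a set \<open>J\<close> of column indices,
  and a row vector on these columns is a function \<open>v\<close> on \<open>J\<close>.  The index is a natural number.
\<close>

definition orthogonal_array ::
    "'a mat \<Rightarrow> 'a set \<Rightarrow> nat \<Rightarrow> nat \<Rightarrow> nat \<Rightarrow> nat \<Rightarrow> nat \<Rightarrow> bool" where
  "orthogonal_array A S M n q t l \<longleftrightarrow>
     finite S \<and> card S = q \<and> A \<in> carrier_mat M n \<and> elements_mat A \<subseteq> S \<and>
     (\<forall>J. J \<subseteq> {..<n} \<and> card J = t \<longrightarrow>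
       (\<forall>v \<in> J \<rightarrow>\<^sub>E S. card {i. i < M \<and> (\<forall>j\<in>J. A $$ (i, j) = v j)} = l))"

definition hamming_weight :: "'a::zero vec \<Rightarrow> nat" where
  "hamming_weight w = card {i. i < dim_vec w \<and> w $ i \<noteq> 0}"

text \<open>\<open>of_bool\<close> lifts the inner product over GF(2) to the exponent \<open>0\<close> or \<open>1\<close>.\<close>

definition fourier_transform :: "nat \<Rightarrow> (bit vec \<Rightarrow> real) \<Rightarrow> bit vec \<Rightarrow> real" where
  "fourier_transform n f w =
     (\<Sum>x \<in> carrier_vec n. f x * (-1) ^ (of_bool (w \<bullet> x = 1) :: nat))"

end

theory Submission
  imports Defs
begin

text \<open>
  The proof is Fourier inversion on the coordinates in a set \<open>J\<close>.  Identify GF(2) with the signs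
  \<open>1\<close> and \<open>-1\<close>; the character attached to \<open>w\<close> then sends \<open>x\<close> to the product of the signs of the
  entries of \<open>x\<close> over the support \<open>K\<close> of \<open>w\<close>.  Write \<open>char_sum C K\<close> for the sum of this character
  over \<open>C\<close>, and \<open>pattern_count C J v\<close> for the number of vectors of \<open>C\<close> that agree with \<open>v\<close> on \<open>J\<close>.
  For \<open>K \<subseteq> J\<close> the two families of numbers determine each other.

  Since the character depends only on the coordinates in \<open>J\<close>, \<open>char_sum C K\<close> is the sum over all \<open>v\<close>
  of \<open>pattern_count C J v\<close> times the character of \<open>v\<close>
  (\<open>char_sum_eq_sum_pattern_count\<close>).  If all counts are equal, what remains is a character sum over
  the whole group, which is \<open>0\<close> when \<open>K\<close> is nonempty.

  Conversely, \<open>bit_sign a * bit_sign b + 1\<close> is \<open>2\<close> or \<open>0\<close> according to whether \<open>a = b\<close>, so a product of such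
  factors over \<open>J\<close> detects agreement with \<open>v\<close>, and expanding it gives
  \<open>pattern_count C J v * 2 ^ card J\<close> as a signed sum of the \<open>char_sum C K\<close>
  (\<open>pattern_count_inversion\<close>).  If these vanish for nonempty \<open>K\<close>, the count is
  \<open>card C / 2 ^ card J\<close>, whatever \<open>v\<close> is.
\<close>

section \<open>Characters of GF(2)\<close>

definition bit_sign :: "bit \<Rightarrow> real" where
  "bit_sign b = (if b = 1 then -1 else 1)"

definition char_sum :: "bit vec set \<Rightarrow> nat set \<Rightarrow> real" where
  "char_sum C K = (\<Sum>x\<in>C. \<Prod>j\<in>K. bit_sign (x $ j))"

definition pattern_count :: "'a vec set \<Rightarrow> nat set \<Rightarrow> (nat \<Rightarrow> 'a) \<Rightarrow> nat" where
  "pattern_count C J v = card {x \<in> C. \<forall>j\<in>J. x $ j = v j}"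

definition support :: "'a::zero vec \<Rightarrow> nat set" where
  "support w = {i. i < dim_vec w \<and> w $ i \<noteq> 0}"

lemma UNIV_bit: "(UNIV :: bit set) = {0, 1}"
  using bit_not_one_iff by blast

lemma finite_UNIV_bit [simp]: "finite (UNIV :: bit set)"
  by (simp add: UNIV_bit)

lemma finite_carrier_vec_bit: "finite (carrier_vec n :: bit vec set)"
proof (rule finite_surj)
  show "finite ({..<n} \<rightarrow>\<^sub>E (UNIV :: bit set))"
    by (intro finite_PiE) auto
  show "carrier_vec n \<subseteq> vec n ` ({..<n} \<rightarrow>\<^sub>E (UNIV :: bit set))"
  proof
    fix x :: "bit vec" assume "x \<in> carrier_vec n"
    then have "x = vec n (restrict (($) x) {..<n})"
      by (intro eq_vecI) auto
    moreover have "restrict (($) x) {..<n} \<in> {..<n} \<rightarrow>\<^sub>E UNIV"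
      by auto
    ultimately show "x \<in> vec n ` ({..<n} \<rightarrow>\<^sub>E UNIV)"
      by blast
  qed
qed

lemma bit_sign_zero [simp]: "bit_sign 0 = 1"
  by (simp add: bit_sign_def)

lemma bit_sign_one [simp]: "bit_sign 1 = -1"
  by (simp add: bit_sign_def)

lemma bit_sign_add: "bit_sign (a + b) = bit_sign a * bit_sign b"
  by (cases a; cases b) (simp_all add: bit_sign_def)

lemma bit_sign_sum: "bit_sign (\<Sum>i\<in>A. f i) = (\<Prod>i\<in>A. bit_sign (f i))"
  by (induction A rule: infinite_finite_induct) (simp_all add: bit_sign_add del: add_bit_eq_xor)

lemma sum_bit_sign: "(\<Sum>b\<in>UNIV. bit_sign b) = 0"
  by (simp add: UNIV_bit)

lemma bit_sign_mult_plus_one: "bit_sign a * bit_sign b + 1 = (if a = b then 2 else 0)"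
  by (cases a; cases b) (simp_all add: bit_sign_def)

section \<open>Fourier coefficients as character sums\<close>

text \<open>Only the entries of \<open>x\<close> on the support of \<open>w\<close> contribute to the inner product.\<close>

lemma fourier_transform_indicator:
  assumes "w \<in> carrier_vec n" "C \<subseteq> carrier_vec n"
  shows "fourier_transform n (indicator C) w = char_sum C (support w)"
proof -
  have char: "(-1) ^ (of_bool (w \<bullet> x = 1) :: nat) = (\<Prod>j\<in>support w. bit_sign (x $ j))"
    if "x \<in> carrier_vec n" for x
  proof -
    have "w \<bullet> x = (\<Sum>i\<in>{0..<n}. w $ i * x $ i)"
      using that by (simp add: scalar_prod_def del: mult_bit_eq_and)
    also have "\<dots> = (\<Sum>i\<in>support w. w $ i * x $ i)"
      using assms by (intro sum.mono_neutral_right) (auto simp: support_def)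
    also have "\<dots> = (\<Sum>i\<in>support w. x $ i)"
      by (intro sum.cong) (auto simp: support_def)
    finally have "bit_sign (w \<bullet> x) = (\<Prod>j\<in>support w. bit_sign (x $ j))"
      by (simp add: bit_sign_sum)
    then show ?thesis
      by (simp add: bit_sign_def split: if_splits)
  qed
  have "fourier_transform n (indicator C) w
      = (\<Sum>x\<in>carrier_vec n. indicator C x * (\<Prod>j\<in>support w. bit_sign (x $ j)))"
    unfolding fourier_transform_def by (intro sum.cong) (simp_all add: char)
  also have "\<dots> = (\<Sum>x\<in>C. indicator C x * (\<Prod>j\<in>support w. bit_sign (x $ j)))"
    using assms finite_carrier_vec_bit by (intro sum.mono_neutral_right) auto
  also have "\<dots> = char_sum C (support w)"
    by (simp add: char_sum_def)
  finally show ?thesis .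
qed

text \<open>Every set of coordinates is a support, so conditions on characters can be stated for sets.\<close>

lemma ex_vec_support_eq:
  assumes "K \<subseteq> {..<n}"
  obtains w :: "bit vec" where "w \<in> carrier_vec n" "support w = K"
proof
  show "vec n (\<lambda>i. of_bool (i \<in> K)) \<in> carrier_vec n"
    by simp
  show "support (vec n (\<lambda>i. of_bool (i \<in> K)) :: bit vec) = K"
    using assms by (auto simp: support_def)
qed

section \<open>Counts and character sums\<close>

text \<open>
  Grouping the vectors of \<open>C\<close> by their restriction to \<open>J\<close>, on which the character is constant.
\<close>

lemma char_sum_eq_sum_pattern_count:
  assumes "finite C" "finite J" "K \<subseteq> J"
  shows "char_sum C K =
    (\<Sum>v\<in>J \<rightarrow>\<^sub>E UNIV. real (pattern_count C J v) * (\<Prod>j\<in>K. bit_sign (v j)))"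
proof -
  let ?r = "\<lambda>x. restrict (($) x) J"
  have fibre: "{x \<in> C. ?r x = v} = {x \<in> C. \<forall>j\<in>J. x $ j = v j}"
    if "v \<in> J \<rightarrow>\<^sub>E UNIV" for v
  proof -
    have "?r x = v \<longleftrightarrow> (\<forall>j\<in>J. x $ j = v j)" for x
      using that PiE_arb [OF that] by (auto simp: restrict_def)
    then show ?thesis by simp
  qed
  have "char_sum C K = (\<Sum>x\<in>C. \<Prod>j\<in>K. bit_sign (?r x j))"
    unfolding char_sum_def using assms(3) by (intro sum.cong prod.cong) auto
  also have "\<dots> = (\<Sum>v\<in>J \<rightarrow>\<^sub>E UNIV. \<Sum>x | x \<in> C \<and> ?r x = v. \<Prod>j\<in>K. bit_sign (?r x j))"
    using assms(1,2) by (intro sum.group [symmetric]) (auto intro: finite_PiE)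
  also have "\<dots> = (\<Sum>v\<in>J \<rightarrow>\<^sub>E UNIV. real (pattern_count C J v) * (\<Prod>j\<in>K. bit_sign (v j)))"
  proof (rule sum.cong [OF refl])
    fix v :: "nat \<Rightarrow> bit" assume v: "v \<in> J \<rightarrow>\<^sub>E UNIV"
    have "(\<Sum>x | x \<in> C \<and> ?r x = v. \<Prod>j\<in>K. bit_sign (?r x j))
        = (\<Sum>x | x \<in> C \<and> ?r x = v. \<Prod>j\<in>K. bit_sign (v j))"
      by (intro sum.cong) auto
    then show "(\<Sum>x | x \<in> C \<and> ?r x = v. \<Prod>j\<in>K. bit_sign (?r x j))
        = real (pattern_count C J v) * (\<Prod>j\<in>K. bit_sign (v j))"
      by (simp add: pattern_count_def fibre [OF v])
  qed
  finally show ?thesis .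
qed

text \<open>
  A coordinate in \<open>K\<close> contributes the factor \<open>1 + (-1) = 0\<close> to the sum, which is a product over \<open>J\<close>.
\<close>

lemma sum_prod_bit_sign_eq_0:
  assumes "finite J" "K \<subseteq> J" "K \<noteq> {}"
  shows "(\<Sum>v\<in>J \<rightarrow>\<^sub>E UNIV. \<Prod>j\<in>K. bit_sign (v j)) = 0"
proof -
  let ?g = "\<lambda>j b. if j \<in> K then bit_sign b else 1"
  have "(\<Sum>v\<in>J \<rightarrow>\<^sub>E UNIV. \<Prod>j\<in>K. bit_sign (v j)) = (\<Sum>v\<in>J \<rightarrow>\<^sub>E UNIV. \<Prod>j\<in>J. ?g j (v j))"
    using assms(1,2) by (intro sum.cong prod.mono_neutral_cong_left) auto
  also have "\<dots> = (\<Prod>j\<in>J. \<Sum>b\<in>UNIV. ?g j b)"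
    using assms(1) by (intro prod_sum_PiE [symmetric]) auto
  also have "\<dots> = 0"
  proof -
    obtain k where k: "k \<in> K" using assms(3) by blast
    then have "(\<Sum>b\<in>UNIV. ?g k b) = 0"
      by (simp add: sum_bit_sign)
    moreover have "k \<in> J"
      using k assms(2) by blast
    ultimately show ?thesis
      using assms(1) by (intro prod_zero) blast+
  qed
  finally show ?thesis .
qed

text \<open>Fourier inversion: the characters of \<open>K \<subseteq> J\<close> recover the counts on \<open>J\<close>.\<close>

lemma pattern_count_inversion:
  assumes "finite C" "finite J"
  shows "real (pattern_count C J v) * 2 ^ card J =
    (\<Sum>K\<in>Pow J. (\<Prod>j\<in>K. bit_sign (v j)) * char_sum C K)"
proof -
  have detect: "(\<Prod>j\<in>J. bit_sign (v j) * bit_sign (x $ j) + 1)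
      = (if \<forall>j\<in>J. x $ j = v j then 2 ^ card J else 0)" for x
  proof -
    have "(\<Prod>j\<in>J. bit_sign (v j) * bit_sign (x $ j) + 1) = (\<Prod>j\<in>J. if x $ j = v j then 2 else 0)"
      by (intro prod.cong) (auto simp: bit_sign_mult_plus_one)
    then show ?thesis
      using assms(2) by (simp add: prod_zero)
  qed
  have "real (pattern_count C J v) * 2 ^ card J
      = (\<Sum>x\<in>C. if \<forall>j\<in>J. x $ j = v j then 2 ^ card J else 0)"
    using assms(1) by (simp add: pattern_count_def sum.If_cases Int_def)
  also have "\<dots> = (\<Sum>x\<in>C. \<Prod>j\<in>J. bit_sign (v j) * bit_sign (x $ j) + 1)"
    by (simp only: detect)
  also have "\<dots> = (\<Sum>x\<in>C. \<Sum>K\<in>Pow J. \<Prod>j\<in>K. bit_sign (v j) * bit_sign (x $ j))"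
    using assms(2) by (simp add: prod_add)
  also have "\<dots> = (\<Sum>K\<in>Pow J. \<Sum>x\<in>C. \<Prod>j\<in>K. bit_sign (v j) * bit_sign (x $ j))"
    by (rule sum.swap)
  also have "\<dots> = (\<Sum>K\<in>Pow J. (\<Prod>j\<in>K. bit_sign (v j)) * char_sum C K)"
    by (simp add: char_sum_def prod.distrib sum_distrib_left)
  finally show ?thesis .
qed

section \<open>Orthogonal arrays\<close>

lemma card_rows_eq_pattern_count:
  assumes "distinct rs" "set rs \<subseteq> carrier_vec n" "J \<subseteq> {..<n}"
  shows "card {i. i < length rs \<and> (\<forall>j\<in>J. mat_of_rows n rs $$ (i, j) = v j)}
    = pattern_count (set rs) J v"
proof -
  have "bij_betw ((!) rs) {i. i < length rs \<and> (\<forall>j\<in>J. mat_of_rows n rs $$ (i, j) = v j)}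
      {x \<in> set rs. \<forall>j\<in>J. x $ j = v j}"
  proof (rule bij_betw_imageI)
    show "inj_on ((!) rs) {i. i < length rs \<and> (\<forall>j\<in>J. mat_of_rows n rs $$ (i, j) = v j)}"
      using assms(1) by (auto simp: inj_on_def nth_eq_iff_index_eq)
    have "mat_of_rows n rs $$ (i, j) = rs ! i $ j" if "i < length rs" "j \<in> J" for i j
      using that assms(3) by (intro mat_of_rows_index) auto
    then show "(!) rs ` {i. i < length rs \<and> (\<forall>j\<in>J. mat_of_rows n rs $$ (i, j) = v j)}
        = {x \<in> set rs. \<forall>j\<in>J. x $ j = v j}"
      by (force simp: in_set_conv_nth image_iff)
  qed
  then show ?thesis
    unfolding pattern_count_def by (rule bij_betw_same_card)
qed

lemma orthogonal_array_mat_of_rows_iff: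
  fixes rs :: "bit vec list"
  assumes "distinct rs" "set rs \<subseteq> carrier_vec n"
  shows "orthogonal_array (mat_of_rows n rs) UNIV (card (set rs)) n 2 t l \<longleftrightarrow>
    (\<forall>J. J \<subseteq> {..<n} \<and> card J = t \<longrightarrow> (\<forall>v \<in> J \<rightarrow>\<^sub>E UNIV. pattern_count (set rs) J v = l))"
proof -
  have "card (UNIV :: bit set) = 2"
    by (simp add: UNIV_bit)
  then show ?thesis
    using card_rows_eq_pattern_count [OF assms]
    by (auto simp: orthogonal_array_def distinct_card [OF assms(1)])
qed

theorem theorem40:
  fixes n t :: nat and C :: "bit vec set" and rs :: "bit vec list"
  assumes "1 \<le> t" and "t \<le> n"
    and "C \<subseteq> carrier_vec n" and "C \<noteq> {}"
    and "set rs = C" and "distinct rs"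
  shows "(\<exists>l::nat. real l = real (card C) / 2 ^ t \<and>
            orthogonal_array (mat_of_rows n rs) (UNIV :: bit set) (card C) n 2 t l)
         \<longleftrightarrow> (\<forall>w \<in> carrier_vec n. 1 \<le> hamming_weight w \<and> hamming_weight w \<le> t \<longrightarrow>
                fourier_transform n (indicator C) w = 0)"
proof -
  have finC: "finite C"
    using assms(5) by auto
  have array_iff: "orthogonal_array (mat_of_rows n rs) UNIV (card C) n 2 t l \<longleftrightarrow>
      (\<forall>J. J \<subseteq> {..<n} \<and> card J = t \<longrightarrow> (\<forall>v \<in> J \<rightarrow>\<^sub>E UNIV. pattern_count C J v = l))" for l
    using orthogonal_array_mat_of_rows_iff [of rs n t l] assms by simp
  have weight: "hamming_weight w = card (support w)" for w :: "bit vec"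
    by (simp add: hamming_weight_def support_def)
  show ?thesis
  proof
    assume "\<exists>l. real l = real (card C) / 2 ^ t \<and>
      orthogonal_array (mat_of_rows n rs) (UNIV :: bit set) (card C) n 2 t l"
    then obtain l where count: "\<And>J v. \<lbrakk>J \<subseteq> {..<n}; card J = t; v \<in> J \<rightarrow>\<^sub>E UNIV\<rbrakk>
        \<Longrightarrow> pattern_count C J v = l"
      using array_iff by blast
    show "\<forall>w \<in> carrier_vec n. 1 \<le> hamming_weight w \<and> hamming_weight w \<le> t \<longrightarrow>
      fourier_transform n (indicator C) w = 0"
    proof (intro ballI impI)
      fix w :: "bit vec"
      assume w: "w \<in> carrier_vec n" and wt: "1 \<le> hamming_weight w \<and> hamming_weight w \<le> t"
      let ?K = "support w"
      have sub: "?K \<subseteq> {..<n}"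
        using w by (auto simp: support_def)
      have ne: "?K \<noteq> {}"
        using wt by (auto simp: weight)
      \<comment> \<open>The array condition speaks of exactly \<open>t\<close> columns, so the support is enlarged to such a set.\<close>
      obtain J where J: "?K \<subseteq> J" "J \<subseteq> {..<n}" "card J = t"
        using exists_subset_between [of ?K t "{..<n}"] sub wt assms(2) by (auto simp: weight)
      have finJ: "finite J"
        using J(2) finite_subset by blast
      have "char_sum C ?K = (\<Sum>v\<in>J \<rightarrow>\<^sub>E UNIV. real l * (\<Prod>j\<in>?K. bit_sign (v j)))"
        unfolding char_sum_eq_sum_pattern_count [OF finC finJ J(1)]
        using count [OF J(2,3)] by (intro sum.cong) auto
      also have "\<dots> = real l * (\<Sum>v\<in>J \<rightarrow>\<^sub>E UNIV. \<Prod>j\<in>?K. bit_sign (v j))"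
        by (rule sum_distrib_left [symmetric])
      also have "\<dots> = 0"
        using sum_prod_bit_sign_eq_0 [OF finJ J(1) ne] by simp
      finally show "fourier_transform n (indicator C) w = 0"
        using fourier_transform_indicator [OF w assms(3)] by simp
    qed
  next
    assume vanish: "\<forall>w \<in> carrier_vec n. 1 \<le> hamming_weight w \<and> hamming_weight w \<le> t \<longrightarrow>
      fourier_transform n (indicator C) w = 0"
    have char0: "char_sum C K = 0" if K: "K \<subseteq> {..<n}" "K \<noteq> {}" "card K \<le> t" for K
    proof -
      obtain w :: "bit vec" where w: "w \<in> carrier_vec n" "support w = K"
        using ex_vec_support_eq [OF K(1)] by blast
      have "finite K"
        using K(1) finite_subset by blast
      then have "1 \<le> card K"
        using K(2) by (simp add: Suc_le_eq card_gt_0_iff)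
      then show ?thesis
        using vanish w K(3) fourier_transform_indicator [OF w(1) assms(3)]
        by (auto simp: weight)
    qed
    have count: "real (pattern_count C J v) = real (card C) / 2 ^ t"
      if J: "J \<subseteq> {..<n}" "card J = t" for J v
    proof -
      have finJ: "finite J"
        using J(1) finite_subset by blast
      have "real (pattern_count C J v) * 2 ^ t
          = (\<Sum>K\<in>Pow J. (\<Prod>j\<in>K. bit_sign (v j)) * char_sum C K)"
        using pattern_count_inversion [OF finC finJ] J(2) by simp
      \<comment> \<open>Only the trivial character survives.\<close>
      also have "\<dots> = (\<Sum>K\<in>{{}}. (\<Prod>j\<in>K. bit_sign (v j)) * char_sum C K)"
        using J finJ card_mono [OF finJ] by (intro sum.mono_neutral_right) (auto intro!: char0)
      also have "\<dots> = real (card C)"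
        by (simp add: char_sum_def)
      finally show ?thesis
        by (simp add: field_simps)
    qed
    \<comment> \<open>The quotient \<open>card C / 2 ^ t\<close> is a natural number because it is the count on some \<open>t\<close> columns,
      which exist as \<open>t \<le> n\<close>.\<close>
    define l where "l = pattern_count C {..<t} (\<lambda>_. 0)"
    have l: "real l = real (card C) / 2 ^ t"
      unfolding l_def using assms(2) by (intro count) auto
    have "pattern_count C J v = l" if "J \<subseteq> {..<n}" "card J = t" for J v
      using count [OF that, of v] l by (metis of_nat_eq_iff)
    then show "\<exists>l. real l = real (card C) / 2 ^ t \<and>
      orthogonal_array (mat_of_rows n rs) (UNIV :: bit set) (card C) n 2 t l"
      using l array_iff by blast
  qed
qed

end
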